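(* Let $t\ge 1$ be an integer, let $G$ be the graph obtained by adding a universal vertex to the disjoint union of two cliques $K_t$, and let $n=|V(G)|=2t+1$. Let $c_i$ be the coefficient of $x^i$ in $\det(D(G)-xI)$, where $D(G)$ is the distance matrix of $G$. Then the sequence $(-1)^{n-1}c_0,\ldots,(-1)^{n-1}c_{n-2}$ is unimodal with peak at $\lfloor \frac n2\rfloor$.
   Context: $K_t$ is the complete graph on $t$ vertices. A universal vertex is a vertex adjacent to all other vertices. The distance matrix $D(G)$ of a connected graph $G$ has $(u,v)$-entry equal to the length of a shortest path between $u$ and $v$. A finite real sequence $a_0,\ldots,a_N$ is unimodal with peak at $m$ if $a_{i-1}\le a_i$ for all $1\le i\le m$ and $a_i\ge a_{i+1}$ for all $m\le i\le N-1$. *)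

theory Defs
  imports
    "Graph_Theory.Graph_Theory"
    "Jordan_Normal_Form.Char_Poly"
begin

text \<open>
  Undirected simple graphs are symmetric digraphs whose arcs are pairs of vertices.
  The definition below is meant for \<open>u \<notin> verts H\<close>; otherwise it would create a loop at \<open>u\<close>.
\<close>

definition add_universal_vertex :: "'a \<Rightarrow> ('a, 'b) pre_digraph \<Rightarrow> 'a pair_pre_digraph" where
  "add_universal_vertex u H =
     \<lparr> pverts = insert u (verts H),
       parcs = arcs_ends H \<union> {u} \<times> verts H \<union> verts H \<times> {u} \<rparr>"

text \<open>
  The library's shortest path distance \<open>wf_digraph.\<mu>\<close>, an extended real, for unit arc weights.
  The lemma \<open>graph_dist_eq_Least\<close> below spells it out as the least length of a path.
\<close>

definition graph_dist :: "('a, 'b) pre_digraph \<Rightarrow> 'a \<Rightarrow> 'a \<Rightarrow> real" where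
  "graph_dist G u v = real_of_ereal (wf_digraph.\<mu> G (\<lambda>_. 1) u v)"

text \<open>The rows and columns are indexed by the position of the vertices in the list \<open>vs\<close>.\<close>

definition distance_matrix :: "('a, 'b) pre_digraph \<Rightarrow> 'a list \<Rightarrow> real mat" where
  "distance_matrix G vs =
     mat (length vs) (length vs) (\<lambda>(i, j). graph_dist G (vs ! i) (vs ! j))"

text \<open>
  \<open>det (A - x I)\<close> as a polynomial in \<open>x\<close>. It differs from \<^const>\<open>char_poly\<close>, which is
  \<open>det (x I - A)\<close>, by the sign \<open>(-1) ^ n\<close>.
\<close>

definition det_minus_xI :: "'a :: comm_ring_1 mat \<Rightarrow> 'a poly" where
  "det_minus_xI A = det (map_mat (\<lambda>a. [:a:]) A - [:0, 1:] \<cdot>\<^sub>m 1\<^sub>m (dim_row A))"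

text \<open>Only the values \<open>a 0, \<dots>, a N\<close> matter.\<close>

definition unimodal_with_peak :: "(nat \<Rightarrow> real) \<Rightarrow> nat \<Rightarrow> nat \<Rightarrow> bool" where
  "unimodal_with_peak a N m \<longleftrightarrow>
     m \<le> N \<and>
     (\<forall>i. 1 \<le> i \<and> i \<le> m \<longrightarrow> a (i - 1) \<le> a i) \<and>
     (\<forall>i. m \<le> i \<and> i < N \<longrightarrow> a i \<ge> a (i + 1))"

lemma graph_dist_eq_Least:
  assumes "wf_digraph G" and "\<exists>p. pre_digraph.apath G u p v"
  shows "graph_dist G u v = real (LEAST k. \<exists>p. pre_digraph.apath G u p v \<and> length p = k)"
proof -
  interpret wf_digraph G by fact
  let ?k = "LEAST k. \<exists>p. apath u p v \<and> length p = k"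
  have cost: "awalk_cost (\<lambda>_. 1) p = real (length p)" for p
    by (induction p) (auto simp: awalk_cost_def)
  from assms(2) have "\<exists>k p. apath u p v \<and> length p = k" by blast
  then have "\<exists>p. apath u p v \<and> length p = ?k"
    by (rule LeastI_ex)
  then obtain p where p: "apath u p v" "length p = ?k" by blast
  have least: "?k \<le> length q" if "awalk u q v" for q
  proof -
    have "apath u (awalk_to_apath q) v" using that by (rule apath_awalk_to_apath)
    then have "?k \<le> length (awalk_to_apath q)" by (intro Least_le) blast
    also have "\<dots> = card (set (awalk_to_apath q))"
      using \<open>apath u (awalk_to_apath q) v\<close>
      by (auto simp: apath_def distinct_card dest: distinct_verts_imp_distinct)
    also have "\<dots> \<le> card (set q)"
      using that by (intro card_mono awalk_to_apath_subset) auto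
    also have "\<dots> \<le> length q" by (rule card_length)
    finally show ?thesis .
  qed
  have "\<mu> (\<lambda>_. 1) u v = ereal (real ?k)"
    unfolding \<mu>_def cost
  proof (rule antisym)
    show "(INF p\<in>{p. awalk u p v}. ereal (real (length p))) \<le> ereal (real ?k)"
      using p by (intro INF_lower2[of p]) (auto simp: apath_def)
    show "ereal (real ?k) \<le> (INF p\<in>{p. awalk u p v}. ereal (real (length p)))"
      using least by (intro INF_greatest) auto
  qed
  then show ?thesis by (simp add: graph_dist_def)
qed

lemma
  assumes A: "complete_digraph t (with_proj A)" and B: "complete_digraph t (with_proj B)"
    and disjoint: "pverts A \<inter> pverts B = {}" and u: "u \<notin> pverts A \<union> pverts B"
  defines "G \<equiv> add_universal_vertex u (union (with_proj A) (with_proj B))"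
  shows pair_graph_cone: "pair_graph G"
    and card_pverts_cone: "card (pverts G) = 2 * t + 1"
proof -
  have fin: "finite (pverts A)" "finite (pverts B)" "card (pverts A) = t" "card (pverts B) = t"
    and arcs: "parcs A = {(x, y). (x, y) \<in> pverts A \<times> pverts A \<and> x \<noteq> y}"
      "parcs B = {(x, y). (x, y) \<in> pverts B \<times> pverts B \<and> x \<noteq> y}"
    using A B by (simp_all add: complete_digraph_pair_def)
  have verts: "pverts G = insert u (pverts A \<union> pverts B)"
    by (simp add: G_def add_universal_vertex_def)
  have "arcs_ends (union (with_proj A) (with_proj B)) = parcs A \<union> parcs B"
    by (auto simp: arcs_ends_def arc_to_ends_def)
  then have parcs: "parcs G = parcs A \<union> parcs B \<union>
      {u} \<times> (pverts A \<union> pverts B) \<union> (pverts A \<union> pverts B) \<times> {u}"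
    by (simp add: G_def add_universal_vertex_def)
  show "card (pverts G) = 2 * t + 1"
    using fin u disjoint by (simp add: verts card_Un_disjoint)
  have "parcs G \<subseteq> pverts G \<times> pverts G"
    by (auto simp: parcs verts arcs)
  moreover have "finite (pverts G)" using fin by (simp add: verts)
  ultimately have "finite (parcs G)" by (meson finite_SigmaI finite_subset)
  moreover have "sym (parcs G)" by (auto simp: parcs arcs intro!: symI)
  moreover have "fst e \<noteq> snd e" if "e \<in> parcs G" for e
    using that u by (auto simp: parcs arcs)
  ultimately show "pair_graph G"
    using \<open>parcs G \<subseteq> _\<close> \<open>finite (pverts G)\<close>
    by unfold_locales (auto simp: symmetric_def)
qed

end

theory Submission
  imports Defs
begin

text \<open>
  The vertices fall into three classes, the two cliques and the universal vertex. Every distance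
  is 0, 1 or 2, and off the diagonal it depends only on the classes of its two vertices. Counting
  two equal vertices as members of one class at distance 1, the distance matrix is \<open>P W P\<^sup>T - I\<close>,
  where \<open>P\<close> is the incidence matrix of vertices and classes and
  \<open>W = [[1, 2, 1], [2, 1, 1], [1, 1, 1]]\<close>. With \<open>y = - (x + 1)\<close>, the determinant of
  \<open>D - x I = y I + P W P\<^sup>T\<close> reduces by Sylvester's identity to that of the \<open>3 \<times> 3\<close> matrix
  \<open>y I + W P\<^sup>T P\<close>, where \<open>P\<^sup>T P = diag (t, t, 1)\<close>
  (lemmas \<open>det_add_mult_commute\<close> and \<open>det_block_constant\<close>). This gives
  \<open>det (D - x I) = (1 + x)\<^sup>2\<^sup>t\<^sup>-\<^sup>2 (2t (t + 1) + (3t\<^sup>2 + 4t - 1) x + (2t - 2) x\<^sup>2 - x\<^sup>3)\<close>,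
  whatever the order of the vertices. As \<open>n - 1 = 2t\<close> is even, the signs in the claim are trivial.

  For unimodality, multiply by \<open>1 - x\<close>: the coefficients become the differences of consecutive
  \<open>c\<^sub>i\<close>, and \<open>(1 - x) (1 + x)\<^sup>M\<^sup>-\<^sup>1\<close> with \<open>M = 2t - 1\<close> has coefficients
  \<open>e\<^sub>j / M\<close>, where \<open>e\<^sub>j = (M - 2j) (M choose j)\<close>. These are nonnegative for \<open>j < t\<close>,
  nonpositive for \<open>j \<ge> t\<close>, and antisymmetric about \<open>M / 2\<close>. Up to the positive factor \<open>M\<close>,
  the difference \<open>c\<^sub>i - c\<^sub>i\<^sub>-\<^sub>1\<close> is
  \<open>2t (t + 1) e\<^sub>i + (3t\<^sup>2 + 4t - 1) e\<^sub>i\<^sub>-\<^sub>1 + (2t - 2) e\<^sub>i\<^sub>-\<^sub>2 - e\<^sub>i\<^sub>-\<^sub>3\<close>.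
  The first three terms have the sign wanted except close to the peak, where antisymmetry makes
  neighbouring terms cancel favourably. The last term has the opposite sign, but
  the third term absorbs it, because \<open>\<bar>e\<^sub>j\<bar> \<le> (M - 1) \<bar>e\<^sub>j\<^sub>+\<^sub>1\<bar>\<close> away from
  the centre (lemmas \<open>centred_binomial_le_rising\<close> and \<open>centred_binomial_ge_falling\<close>).
\<close>

section \<open>Determinants of class-constant perturbations of scalar matrices\<close>

text \<open>
  Sylvester's identity \<open>det (y I + A B) = y\<^sup>n\<^sup>-\<^sup>k det (y I + B A)\<close>, in a division-free form that
  is valid for any \<open>n\<close> and \<open>k\<close>. The block matrix \<open>[[y I, A], [-B, I]]\<close> can be made block
  triangular from the left, which leaves \<open>y I + A B\<close> on the diagonal, or from the right, which
  leaves \<open>y I + B A\<close>.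
\<close>

lemma det_add_mult_commute:
  fixes y :: "'a :: idom"
  assumes A: "A \<in> carrier_mat n k" and B: "B \<in> carrier_mat k n"
  shows "y ^ k * det (y \<cdot>\<^sub>m 1\<^sub>m n + A * B) = y ^ n * det (y \<cdot>\<^sub>m 1\<^sub>m k + B * A)"
proof -
  let ?M = "four_block_mat (y \<cdot>\<^sub>m 1\<^sub>m n) A (- B) (1\<^sub>m k)"
  let ?U = "four_block_mat (1\<^sub>m n) (- A) (0\<^sub>m k n) (1\<^sub>m k)"
  let ?V = "four_block_mat (1\<^sub>m n) (- A) (0\<^sub>m k n) (y \<cdot>\<^sub>m 1\<^sub>m k)"
  have carriers: "?M \<in> carrier_mat (n + k) (n + k)" "?U \<in> carrier_mat (n + k) (n + k)"
    "?V \<in> carrier_mat (n + k) (n + k)"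
    by (auto intro!: four_block_carrier_mat)
  have "?U * ?M = four_block_mat (y \<cdot>\<^sub>m 1\<^sub>m n + A * B) (0\<^sub>m n k) (- B) (1\<^sub>m k)"
    using A B by (subst mult_four_block_mat[of _ n n _ k _ k _ _ n _ k]) auto
  then have "det (?U * ?M) = det (y \<cdot>\<^sub>m 1\<^sub>m n + A * B)"
    using A B by (simp add: det_four_block_mat_upper_right_zero[of _ n _ k])
  moreover have "det ?U = 1"
    using A by (subst det_four_block_mat_lower_left_zero[of _ n _ k]) auto
  ultimately have M: "det ?M = det (y \<cdot>\<^sub>m 1\<^sub>m n + A * B)"
    using carriers by (simp add: det_mult[of _ "n + k"])
  have corner: "(y \<cdot>\<^sub>m 1\<^sub>m n) * (- A) + A * (y \<cdot>\<^sub>m 1\<^sub>m k) = 0\<^sub>m n k"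
    using A by (auto simp: mult_smult_distrib[of _ n k])
  have lower: "(- B) * (- A) + 1\<^sub>m k * (y \<cdot>\<^sub>m 1\<^sub>m k) = y \<cdot>\<^sub>m 1\<^sub>m k + B * A"
    using A B by (auto simp: comm_add_mat[of _ k k])
  have "?M * ?V = four_block_mat (y \<cdot>\<^sub>m 1\<^sub>m n) (0\<^sub>m n k) (- B) (y \<cdot>\<^sub>m 1\<^sub>m k + B * A)"
    using A B corner lower by (subst mult_four_block_mat[of _ n n _ k _ k _ _ n _ k]) auto
  then have "det (?M * ?V) = y ^ n * det (y \<cdot>\<^sub>m 1\<^sub>m k + B * A)"
    using A B by (simp add: det_four_block_mat_upper_right_zero[of _ n _ k])
  moreover have "det ?V = y ^ k"
    using A by (subst det_four_block_mat_lower_left_zero[of _ n _ k]) auto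
  ultimately show ?thesis
    using carriers M by (simp add: det_mult[of _ "n + k"] mult.commute)
qed

text \<open>
  The indices \<open>0, \<dots>, n - 1\<close> are partitioned into the classes \<open>0, \<dots>, k - 1\<close>, and \<open>W\<close> prescribes the
  entries by class. Such a matrix factors through the \<open>k\<close> classes, so Sylvester's identity applies,
  and the product in the reverse order only sees \<open>W\<close> and the class sizes. Hence
  the determinant is the same for every order of the indices.
\<close>

lemma det_block_constant:
  fixes W :: "nat \<Rightarrow> nat \<Rightarrow> 'a :: idom" and cls :: "nat \<Rightarrow> nat"
  assumes cls: "\<And>i. i < n \<Longrightarrow> cls i < k"
  shows "y ^ k * det (mat n n (\<lambda>(i, j). (if i = j then y else 0) + W (cls i) (cls j)))
       = y ^ n * det (mat k k (\<lambda>(a, b). (if a = b then y else 0)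
                                  + W a b * of_nat (card {j. j < n \<and> cls j = b})))"
proof -
  define A where "A = mat n k (\<lambda>(i, a). if cls i = a then 1 else 0 :: 'a)"
  define B where "B = mat k n (\<lambda>(a, j). W a (cls j))"
  have carriers: "A \<in> carrier_mat n k" "B \<in> carrier_mat k n"
    by (simp_all add: A_def B_def)
  have "mat n n (\<lambda>(i, j). (if i = j then y else 0) + W (cls i) (cls j)) = y \<cdot>\<^sub>m 1\<^sub>m n + A * B"
    using cls by (intro eq_matI) (auto simp: A_def B_def scalar_prod_def if_distrib[of "\<lambda>x. x * _"] cong: if_cong)
  moreover have "mat k k (\<lambda>(a, b). (if a = b then y else 0)
      + W a b * of_nat (card {j. j < n \<and> cls j = b})) = y \<cdot>\<^sub>m 1\<^sub>m k + B * A"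
  proof (intro eq_matI)
    fix a b assume "a < dim_row (y \<cdot>\<^sub>m 1\<^sub>m k + B * A)" "b < dim_col (y \<cdot>\<^sub>m 1\<^sub>m k + B * A)"
    then have ab: "a < k" "b < k" by (simp_all add: A_def B_def)
    have "(\<Sum>j = 0..<n. W a (cls j) * (if cls j = b then 1 else 0))
        = (\<Sum>j \<in> {j. j < n \<and> cls j = b}. W a b)"
      by (intro sum.mono_neutral_cong_right) auto
    then show "mat k k (\<lambda>(a, b). (if a = b then y else 0)
        + W a b * of_nat (card {j. j < n \<and> cls j = b})) $$ (a, b) = (y \<cdot>\<^sub>m 1\<^sub>m k + B * A) $$ (a, b)"
      using ab by (auto simp: A_def B_def scalar_prod_def mult.commute)
  qed (simp_all add: A_def B_def)
  ultimately show ?thesis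
    using det_add_mult_commute[OF carriers, of y] by simp
qed

lemma det_mat_3:
  fixes f :: "nat \<times> nat \<Rightarrow> 'a :: comm_ring_1"
  shows "det (mat 3 3 f) =
      f (0, 0) * (f (1, 1) * f (2, 2) - f (1, 2) * f (2, 1))
    - f (0, 1) * (f (1, 0) * f (2, 2) - f (1, 2) * f (2, 0))
    + f (0, 2) * (f (1, 0) * f (2, 1) - f (1, 1) * f (2, 0))"
proof -
  have det2: "det (mat 2 2 g) = g (0, 0) * g (1, 1) - g (0, 1) * g (1, 0)"
    for g :: "nat \<times> nat \<Rightarrow> 'a"
    by (subst laplace_expansion_column[of _ 2 0])
      (auto simp: numeral_2_eq_2 cofactor_def mat_delete_def det_single)
  show ?thesis
    by (subst laplace_expansion_column[of _ 3 0])
      (auto simp: numeral_3_eq_3 cofactor_def mat_delete_def det2[simplified numeral_2_eq_2] numeral_2_eq_2 algebra_simps)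
qed

section \<open>Unimodality of the coefficients\<close>

text \<open>
  This is \<open>M\<close> times the coefficient of \<open>x\<^sup>j\<close> in \<open>(1 - x) (1 + x)\<^sup>M\<^sup>-\<^sup>1\<close>, see
  \<open>coeff_one_minus_x_binomial\<close> below. The index is an integer so that multiplication of the
  polynomial by a power of \<open>x\<close> is a plain shift of the index.
\<close>

definition centred_binomial :: "nat \<Rightarrow> int \<Rightarrow> real" where
  "centred_binomial M j = (if j < 0 then 0 else (real M - 2 * real_of_int j) * real (M choose nat j))"

lemma centred_binomial_nonneg: "2 * j \<le> int M \<Longrightarrow> 0 \<le> centred_binomial M j"
  by (auto simp: centred_binomial_def)

lemma centred_binomial_nonpos: "int M \<le> 2 * j \<Longrightarrow> centred_binomial M j \<le> 0"
  by (auto simp: centred_binomial_def mult_le_0_iff)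

lemma centred_binomial_antisym:
  assumes "0 \<le> j" "j \<le> int M"
  shows "centred_binomial M (int M - j) = - centred_binomial M j"
proof -
  have "M choose nat (int M - j) = M choose nat j"
    using binomial_symmetric[of "nat j" M] assms by (simp add: nat_diff_distrib nat_le_iff)
  then show ?thesis using assms by (simp add: centred_binomial_def algebra_simps)
qed

lemma binomial_step: "(M choose j) * (M - j) = (M choose Suc j) * Suc j"
  by (metis binomial_absorb_comp mult.commute binomial_absorption)

text \<open>
  The binomial coefficients increase here. The factor \<open>M - 2 j\<close> shrinks by 2 from \<open>j\<close> to \<open>j + 1\<close>,
  but as it is at least 5 it shrinks to no less than half of its value; and the bound makes
  \<open>M - 1\<close> at least 2 when \<open>j\<close> is not negative.
\<close>

lemma centred_binomial_le_rising:
  assumes "2 * j + 5 \<le> int M"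
  shows "centred_binomial M j \<le> real (M - 1) * centred_binomial M (j + 1)"
proof (cases "j < 0")
  case True
  then show ?thesis using assms
    by (cases M) (auto simp: centred_binomial_def)
next
  case False
  then have "0 \<le> j" by simp
  then obtain k where j: "j = int k" by (rule nonneg_int_cases)
  from assms j have M: "2 * k + 5 \<le> M" by simp
  have "M choose k \<le> M choose Suc k"
    using M by (intro binomial_mono) auto
  moreover have real_M: "2 * real k + 5 \<le> real M"
    using of_nat_mono[OF M, where ?'a = real] by simp
  moreover have "real M - 2 * real k \<le> real (M - 1) * (real M - 2 * real k - 2)"
  proof -
    have "real M - 2 * real k \<le> 2 * (real M - 2 * real k - 2)"
      using real_M by (simp add: algebra_simps)
    also have "\<dots> \<le> real (M - 1) * (real M - 2 * real k - 2)"
      using M real_M by (intro mult_right_mono) auto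
    finally show ?thesis .
  qed
  ultimately have "(real M - 2 * real k) * real (M choose k)
      \<le> (real (M - 1) * (real M - 2 * real k - 2)) * real (M choose Suc k)"
    using M by (intro mult_mono) auto
  moreover have "nat (1 + int k) = Suc k" by simp
  ultimately show ?thesis by (simp add: j centred_binomial_def algebra_simps)
qed

text \<open>
  Past the centre both sides are at most 0 and the factor \<open>2 j - M\<close> grows with \<open>j\<close>. The binomial
  coefficients decrease, but by a factor \<open>(j + 1) / (M - j) \<le> M - 1\<close> in each step.
\<close>

lemma centred_binomial_ge_falling:
  assumes "int M \<le> 2 * j" "j + 2 \<le> int M"
  shows "real (M - 1) * centred_binomial M (j + 1) \<le> centred_binomial M j"
proof -
  have "0 \<le> j" using assms(1) by simp
  then obtain k where j: "j = int k" by (rule nonneg_int_cases)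
  from assms j have M: "M \<le> 2 * k" "k + 2 \<le> M" by simp_all
  have "M choose k \<le> (M choose k) * (M - k)" using M by simp
  also have "\<dots> = (M choose Suc k) * Suc k" by (rule binomial_step)
  also have "\<dots> \<le> (M choose Suc k) * (M - 1)" using M by (intro mult_le_mono2) simp
  finally have "real (M choose k) \<le> real (M choose Suc k) * real (M - 1)"
    by (metis of_nat_le_iff of_nat_mult)
  then have "(2 * real k - real M) * real (M choose k)
      \<le> (2 * real k + 2 - real M) * (real (M choose Suc k) * real (M - 1))"
    using M by (intro mult_mono) auto
  moreover have "nat (1 + int k) = Suc k" by simp
  ultimately show ?thesis by (simp add: j centred_binomial_def algebra_simps)
qed

lemma coeff_one_minus_x_binomial:
  "real (Suc m) * coeff ([:1, -1:] * [:1, 1:] ^ m) j = centred_binomial (Suc m) (int j)"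
proof (cases j)
  case 0
  then show ?thesis by (simp add: centred_binomial_def coeff_0_power)
next
  case (Suc k)
  have pow: "coeff ([:1, 1:] ^ m) i = real (m choose i)" for i
    using coeff_linear_poly_power[of i m "1 :: real" 1] by (cases "i \<le> m")
      (simp_all add: coeff_eq_0 degree_linear_power)
  have "real (Suc m) * real (m choose Suc k) = real (Suc m - Suc k) * real (Suc m choose Suc k)"
    by (metis binomial_absorb_comp diff_Suc_1 mult.commute of_nat_mult)
  moreover have "real (Suc m) * real (m choose k) = real (Suc k) * real (Suc m choose Suc k)"
    by (metis binomial_absorption diff_Suc_1 mult.commute of_nat_mult)
  moreover have "real (Suc m - Suc k) * real (Suc m choose Suc k)
      = (real m - real k) * real (Suc m choose Suc k)"
    by (cases "k \<le> m") (auto simp: of_nat_diff binomial_eq_0)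
  moreover have "nat (1 + int k) = Suc k" by simp
  ultimately show ?thesis
    by (simp add: Suc centred_binomial_def pow algebra_simps del: binomial_Suc_Suc)
qed

text \<open>
  The cubic is \<open>(x + t + 1) (2t + (3t - 1) x - x\<^sup>2)\<close>. The proof shows the sign of the
  coefficients \<open>\<Delta>\<close> of \<open>M (1 - x) p\<close>, up to and beyond the index \<open>t\<close>.
\<close>

lemma unimodal_cubic_times_binomial:
  assumes t: "t \<ge> 1"
  defines "T \<equiv> real t"
  defines "p \<equiv> [:1, 1:] ^ (2 * t - 2) * [:2 * T * (T + 1), 3 * T\<^sup>2 + 4 * T - 1, 2 * T - 2, -1:]"
  shows "unimodal_with_peak (coeff p) (2 * t - 1) t"
proof -
  define M where "M = 2 * t - 1"
  define e where "e = centred_binomial M"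
  have M: "M = Suc (2 * t - 2)" "int M = 2 * int t - 1" "real (M - 1) = 2 * T - 2" "M > 0"
    using t by (auto simp: M_def T_def)
  have T: "T \<ge> 1" using t by (simp add: T_def)
  define \<Delta> where "\<Delta> i = 2 * T * (T + 1) * e i + (3 * T\<^sup>2 + 4 * T - 1) * e (i - 1)
      + ((2 * T - 2) * e (i - 2) - e (i - 3))" for i
  have diff: "real M * (coeff p (Suc k) - coeff p k) = \<Delta> (int (Suc k))" for k
  proof -
    let ?q = "[:1, -1:] * [:1, 1:] ^ (2 * t - 2) :: real poly"
    \<comment> \<open>Coefficients with integer index, so that multiplying by a linear factor shifts uniformly.\<close>
    let ?cf = "\<lambda>r i. if i < 0 then 0 else coeff r (nat i)"
    have e: "e i = real M * ?cf ?q i" for i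
      using coeff_one_minus_x_binomial[of "2 * t - 2" "nat i"] M
      by (auto simp: e_def centred_binomial_def)
    have shift: "?cf (pCons a r * ?q) i = a * ?cf ?q i + ?cf (r * ?q) (i - 1)" for a r i
    proof -
      have "nat i = Suc (nat (i - 1))" if "0 < i" using that by simp
      then show ?thesis
        unfolding mult_pCons_left by (cases "i = 0"; cases "0 < i")
          (simp_all del: mult_pCons_left mult_pCons_right)
    qed
    have "[:1, -1:] * p = [:2 * T * (T + 1), 3 * T\<^sup>2 + 4 * T - 1, 2 * T - 2, -1:] * ?q"
      unfolding p_def by (simp only: mult_ac)
    moreover have "coeff ([:1, -1:] * p) (Suc k) = coeff p (Suc k) - coeff p k"
      by simp
    moreover have "\<Delta> (int (Suc k)) = real M *
        ?cf ([:2 * T * (T + 1), 3 * T\<^sup>2 + 4 * T - 1, 2 * T - 2, -1:] * ?q) (int (Suc k))"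
      unfolding \<Delta>_def e shift
      by (simp del: mult_pCons_left mult_pCons_right add: algebra_simps)
    moreover have "?cf r (int (Suc k)) = coeff r (Suc k)" for r :: "real poly"
      by (simp del: of_nat_Suc)
    ultimately show ?thesis by (simp only:)
  qed
  \<comment> \<open>The centre \<open>M / 2\<close> of the antisymmetry lies halfway between \<open>t - 1\<close> and \<open>t\<close>.\<close>
  have middle: "e (int t) = - e (int t - 1)"
    using centred_binomial_antisym[of "int t - 1" M] M(2) t by (simp add: e_def)
  have a: "0 \<le> 2 * T * (T + 1)" "0 \<le> 3 * T\<^sup>2 + 4 * T - 1" "0 \<le> 2 * T - 2"
  proof -
    show "0 \<le> 3 * T\<^sup>2 + 4 * T - 1" using T zero_le_power2[of T] by linarith
  qed (use T in auto)
  have rising: "0 \<le> \<Delta> i" if "i \<le> int t" for i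
  proof -
    have "e (i - 3) \<le> (2 * T - 2) * e (i - 2)"
      using centred_binomial_le_rising[of "i - 3" M] that M(2,3) by (simp add: e_def)
    moreover have "0 \<le> 2 * T * (T + 1) * e i + (3 * T\<^sup>2 + 4 * T - 1) * e (i - 1)"
    proof (cases "i = int t")
      \<comment> \<open>Here \<open>e i\<close> is already negative, but it is outweighed by \<open>e (i - 1) = - e i\<close>.\<close>
      case True
      have "0 \<le> T\<^sup>2 + 2 * T - 1" using T zero_le_power2[of T] by linarith
      moreover have "0 \<le> e (int t - 1)"
        using M(2) by (simp add: e_def centred_binomial_nonneg)
      ultimately have "0 \<le> (T\<^sup>2 + 2 * T - 1) * e (int t - 1)" by simp
      then show ?thesis unfolding True middle by (simp add: algebra_simps power2_eq_square)
    next
      case False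
      then show ?thesis
        using a that M(2)
        by (intro add_nonneg_nonneg mult_nonneg_nonneg[of "2 * T * (T + 1)"]
            mult_nonneg_nonneg[of "3 * T\<^sup>2 + 4 * T - 1"])
          (simp_all add: e_def centred_binomial_nonneg)
    qed
    ultimately show ?thesis by (simp add: \<Delta>_def)
  qed
  have falling: "\<Delta> i \<le> 0" if i: "int t < i" "i \<le> int M" for i
  proof -
    have nonpos: "e j \<le> 0" if "int t \<le> j" for j
      using that M(2) by (auto simp: e_def intro: centred_binomial_nonpos)
    have nonneg: "0 \<le> e j" if "j < int t" for j
      using that M(2) by (auto simp: e_def intro: centred_binomial_nonneg)
    note weighted = a[THEN mult_nonneg_nonpos, OF nonpos]
    consider "i = int t + 1" | "i = int t + 2" | "int t + 3 \<le> i" using i by linarith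
    then show ?thesis
    proof cases
      \<comment> \<open>Of the terms of positive weight only the one with \<open>e (i - 2)\<close> may be positive, and it is
        outweighed by the one with \<open>e (i - 1) = - e (i - 2)\<close>.\<close>
      case 1
      have "0 \<le> (3 * T\<^sup>2 + 2 * T + 1) * e (int t - 1)"
        using T nonneg by (intro mult_nonneg_nonneg) auto
      moreover have "0 \<le> e (int t - 2)" using nonneg by simp
      moreover have "2 * T * (T + 1) * e (int t + 1) \<le> 0"
        by (rule weighted(1)) simp
      ultimately show ?thesis unfolding \<Delta>_def 1 using middle by (simp add: algebra_simps)
    next
      \<comment> \<open>Now \<open>i - 3 = t - 1\<close> is still before the centre, so the last term is already favourable.\<close>
      case 2
      have "2 * T * (T + 1) * e i \<le> 0" "(3 * T\<^sup>2 + 4 * T - 1) * e (i - 1) \<le> 0"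
         "(2 * T - 2) * e (i - 2) \<le> 0" "0 \<le> e (i - 3)"
        by (rule weighted nonneg, simp add: 2)+
      then show ?thesis unfolding \<Delta>_def by linarith
    next
      case 3
      have "(2 * T - 2) * e (i - 2) \<le> e (i - 3)"
        using centred_binomial_ge_falling[of M "i - 3", unfolded M(3)] 3 i M(2) by (simp add: e_def)
      moreover have "2 * T * (T + 1) * e i \<le> 0" "(3 * T\<^sup>2 + 4 * T - 1) * e (i - 1) \<le> 0"
        by (rule weighted, use 3 in simp)+
      ultimately show ?thesis unfolding \<Delta>_def by linarith
    qed
  qed
  have step: "coeff p k \<le> coeff p (Suc k) \<longleftrightarrow> 0 \<le> \<Delta> (int (Suc k))"
    "coeff p (Suc k) \<le> coeff p k \<longleftrightarrow> \<Delta> (int (Suc k)) \<le> 0" for k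
    unfolding diff[symmetric] using M(4) by (simp_all add: zero_le_mult_iff mult_le_0_iff)
  show ?thesis
    unfolding unimodal_with_peak_def
  proof (intro conjI allI impI)
    show "t \<le> 2 * t - 1" using t by simp
    fix i
    assume i: "1 \<le> i \<and> i \<le> t"
    then obtain k where "i = Suc k" by (cases i) auto
    then show "coeff p (i - 1) \<le> coeff p i"
      using step(1)[of k] rising[of "int i"] i by simp
  next
    fix i
    assume i: "t \<le> i \<and> i < 2 * t - 1"
    then show "coeff p (i + 1) \<le> coeff p i"
      using step(2)[of i] falling[of "int (Suc i)"] by (simp add: M_def)
  qed
qed

section \<open>The distance matrix of the graph\<close>

lemma graph_dist_diameter_two:
  assumes "wf_digraph (with_proj G)" and x: "x \<in> pverts G"
    and xy: "x \<noteq> y \<Longrightarrow> (x, y) \<notin> parcs G \<Longrightarrow> \<exists>z. z \<noteq> x \<and> z \<noteq> y \<and> (x, z) \<in> parcs G \<and> (z, y) \<in> parcs G"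
  shows "graph_dist (with_proj G) x y = (if x = y then 0 else if (x, y) \<in> parcs G then 1 else 2)"
proof -
  interpret wf_digraph "with_proj G" by fact
  have y: "y \<in> pverts G"
    using x xy wellformed by (metis (no_types) snd_conv with_proj_simps)
  let ?d = "if x = y then 0 else if (x, y) \<in> parcs G then 1 else 2 :: nat"
  have ex: "\<exists>p. apath x p y \<and> length p = ?d"
  proof -
    consider "x = y" | "x \<noteq> y" "(x, y) \<in> parcs G" | "x \<noteq> y" "(x, y) \<notin> parcs G" by blast
    then show ?thesis
    proof cases
      case 1
      then show ?thesis using x by (intro exI[of _ "[]"]) (simp add: apath_simps)
    next
      case 2
      then show ?thesis using x y by (intro exI[of _ "[(x, y)]"]) (simp add: apath_simps)
    next
      case 3
      then obtain z where "z \<noteq> x" "z \<noteq> y" "(x, z) \<in> parcs G" "(z, y) \<in> parcs G" using xy by blast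
      then show ?thesis using 3 y by (intro exI[of _ "[(x, z), (z, y)]"]) (simp add: apath_simps)
    qed
  qed
  have least: "?d \<le> length p" if "apath x p y" for p
    using that by (cases p; cases "tl p") (auto simp: apath_simps)
  have "(LEAST k. \<exists>p. apath x p y \<and> length p = k) = ?d"
    using ex least by (intro Least_equality) auto
  then show ?thesis
    using graph_dist_eq_Least[OF assms(1)] ex by (metis (no_types, lifting) of_nat_0 of_nat_1 of_nat_numeral)
qed

text \<open>
  The diagonal entry \<open>- x\<close> of \<open>D - x I\<close> is split as \<open>- (1 + x) + 1\<close>: the summand 1 is the distance of
  two distinct vertices of one clique, and so the rest of the matrix depends only on the classes.
\<close>

lemma det_minus_xI_two_cliques_cone:
  fixes vs :: "'a list" and D :: "real mat"
  assumes t: "t \<ge> 1" and vs: "distinct vs" "set vs = insert u (VA \<union> VB)"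
    and fin: "finite VA" "finite VB" and card: "card VA = t" "card VB = t"
    and disjoint: "VA \<inter> VB = {}" "u \<notin> VA \<union> VB"
    and D: "D = mat (length vs) (length vs) (\<lambda>(i, j). d (vs ! i) (vs ! j))"
    and d: "\<And>x y. x \<in> set vs \<Longrightarrow> y \<in> set vs \<Longrightarrow>
      d x y = (if x = y then 0 else if x \<in> VA \<and> y \<in> VB \<or> x \<in> VB \<and> y \<in> VA then 2 else 1)"
  shows "det_minus_xI D = [:1, 1:] ^ (2 * t - 2)
    * [:2 * real t * (real t + 1), 3 * (real t)\<^sup>2 + 4 * real t - 1, 2 * real t - 2, -1:]"
proof -
  define kind where "kind x = (if x \<in> VA then 0 else if x \<in> VB then 1 else 2 :: nat)" for x
  define cls where "cls i = kind (vs ! i)" for i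
  define W where "W a b = (if a + b = 1 then [:2:] else [:1 :: real:])" for a b :: nat
  let ?n = "length vs" and ?y = "[:-1, -1 :: real:]"
  have n: "?n = 2 * t + 1"
    using distinct_card[OF vs(1)] vs(2) fin card disjoint by (simp add: card_Un_disjoint)
  have count: "card {j. j < ?n \<and> cls j = a} = card {x \<in> set vs. kind x = a}" for a
  proof -
    have "bij_betw ((!) vs) {j. j < ?n \<and> cls j = a} {x \<in> set vs. kind x = a}"
      using vs(1) by (auto simp: bij_betw_def inj_on_def nth_eq_iff_index_eq cls_def in_set_conv_nth split: if_splits)
    then show ?thesis by (rule bij_betw_same_card)
  qed
  have "{x \<in> set vs. kind x = 0} = VA"
    "{x \<in> set vs. kind x = 1} = VB"
    "{x \<in> set vs. kind x = 2} = {u}"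
    using vs(2) disjoint by (auto simp: kind_def)
  then have counts: "card {j. j < ?n \<and> cls j = 0} = t"
    "card {j. j < ?n \<and> cls j = 1} = t" "card {j. j < ?n \<and> cls j = 2} = 1"
    using card by (simp_all only: count) simp
  have "det_minus_xI D = det (mat ?n ?n (\<lambda>(i, j). (if i = j then ?y else 0) + W (cls i) (cls j)))"
  proof -
    have "map_mat (\<lambda>a. [:a:]) D - [:0, 1:] \<cdot>\<^sub>m 1\<^sub>m (dim_row D)
      = mat ?n ?n (\<lambda>(i, j). (if i = j then ?y else 0) + W (cls i) (cls j))" 
    proof (intro eq_matI)
      fix i j assume "i < dim_row (mat ?n ?n (\<lambda>(i, j). (if i = j then ?y else 0) + W (cls i) (cls j)))"
        "j < dim_col (mat ?n ?n (\<lambda>(i, j). (if i = j then ?y else 0) + W (cls i) (cls j)))"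
      then have ij: "i < ?n" "j < ?n" by auto
      then have mem: "vs ! i \<in> set vs" "vs ! j \<in> set vs" and eq: "vs ! i = vs ! j \<longleftrightarrow> i = j"
        using vs(1) by (auto simp: nth_eq_iff_index_eq)
      then show "(map_mat (\<lambda>a. [:a:]) D - [:0, 1:] \<cdot>\<^sub>m 1\<^sub>m (dim_row D)) $$ (i, j)
        = mat ?n ?n (\<lambda>(i, j). (if i = j then ?y else 0) + W (cls i) (cls j)) $$ (i, j)"
        using ij mem disjoint vs(2) by (auto simp: D d[OF mem] cls_def kind_def W_def one_pCons)
    qed (simp_all add: D)
    then show ?thesis by (simp add: det_minus_xI_def)
  qed
  moreover have "?y ^ 3 * det (mat ?n ?n (\<lambda>(i, j). (if i = j then ?y else 0) + W (cls i) (cls j)))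
     = ?y ^ ?n * det (mat 3 3 (\<lambda>(a, b). (if a = b then ?y else 0)
                                  + W a b * of_nat (card {j. j < ?n \<and> cls j = b})))"
    by (rule det_block_constant) (simp add: cls_def kind_def)
  moreover have "det (mat 3 3 (\<lambda>(a, b). (if a = b then ?y else 0)
                                  + W a b * of_nat (card {j. j < ?n \<and> cls j = b})))
     = [:2 * real t * (real t + 1), 3 * (real t)\<^sup>2 + 4 * real t - 1, 2 * real t - 2, -1:]"
    by (simp add: det_mat_3 counts[simplified] W_def of_nat_poly power2_eq_square algebra_simps)
  moreover have "?y ^ ?n = ?y ^ 3 * [:1, 1:] ^ (2 * t - 2)"
  proof -
    have "?n = 3 + (2 * t - 2)" using n t by simp
    moreover have "?y ^ (2 * t - 2) = [:1, 1:] ^ (2 * t - 2)"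
      using power_minus_even[of "2 * t - 2" "[:1, 1 :: real:]"] by simp
    ultimately show ?thesis by (simp add: power_add)
  qed
  ultimately have "?y ^ 3 * det_minus_xI D = ?y ^ 3 * ([:1, 1:] ^ (2 * t - 2)
    * [:2 * real t * (real t + 1), 3 * (real t)\<^sup>2 + 4 * real t - 1, 2 * real t - 2, -1:])"
    by (simp only: mult.assoc)
  \<comment> \<open>The factor \<open>?y ^ 3\<close> of the division-free identity cancels, since \<open>?n \<ge> 3\<close>.\<close>
  moreover have "?y ^ 3 \<noteq> 0" by simp
  ultimately show ?thesis by (simp only: mult_cancel_left) simp
qed

theorem theorem4p6:
  fixes t n :: nat
    and A B G :: "'a pair_pre_digraph"
    and u :: 'a
    and vs :: "'a list"
    and c :: "nat \<Rightarrow> real"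
  assumes t: "t \<ge> 1"
    and A: "complete_digraph t (with_proj A)"
    and B: "complete_digraph t (with_proj B)"
    and disjoint: "pverts A \<inter> pverts B = {}"
    and u: "u \<notin> pverts A \<union> pverts B"
    and G: "G = add_universal_vertex u (union (with_proj A) (with_proj B))"
    and n: "n = card (pverts G)"
    and vs: "distinct vs" "set vs = pverts G"
    and c: "\<And>i. c i = coeff (det_minus_xI (distance_matrix (with_proj G) vs)) i"
  shows "unimodal_with_peak (\<lambda>i. (-1) ^ (n - 1) * c i) (n - 2) (n div 2)"
proof -
  have fin: "finite (pverts A)" "finite (pverts B)" "card (pverts A) = t" "card (pverts B) = t"
    and arcs: "parcs A = {(x, y). (x, y) \<in> pverts A \<times> pverts A \<and> x \<noteq> y}"
      "parcs B = {(x, y). (x, y) \<in> pverts B \<times> pverts B \<and> x \<noteq> y}"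
    using A B by (simp_all add: complete_digraph_pair_def)
  have verts: "pverts G = insert u (pverts A \<union> pverts B)"
    by (simp add: G add_universal_vertex_def)
  have "arcs_ends (union (with_proj A) (with_proj B)) = parcs A \<union> parcs B"
    by (auto simp: arcs_ends_def arc_to_ends_def)
  then have parcs: "parcs G = parcs A \<union> parcs B \<union>
      {u} \<times> (pverts A \<union> pverts B) \<union> (pverts A \<union> pverts B) \<times> {u}"
    by (simp add: G add_universal_vertex_def)
  interpret pair_graph G
    unfolding G using pair_graph_cone[OF A B disjoint u] .
  have n_eq: "n = 2 * t + 1"
    unfolding n G by (rule card_pverts_cone[OF A B disjoint u])
  have dist: "graph_dist (with_proj G) x y = (if x = y then 0
      else if x \<in> pverts A \<and> y \<in> pverts B \<or> x \<in> pverts B \<and> y \<in> pverts A then 2 else 1)"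
    if "x \<in> set vs" "y \<in> set vs" for x y
  proof -
    have "\<exists>z. z \<noteq> x \<and> z \<noteq> y \<and> (x, z) \<in> parcs G \<and> (z, y) \<in> parcs G"
      if "x \<noteq> y" "(x, y) \<notin> parcs G"
      using that \<open>x \<in> set vs\<close> \<open>y \<in> set vs\<close> u unfolding vs(2)
      by (intro exI[of _ u]) (auto simp: parcs verts)
    then have "graph_dist (with_proj G) x y = (if x = y then 0 else if (x, y) \<in> parcs G then 1 else 2)"
      using that wf_digraph_axioms vs(2) by (intro graph_dist_diameter_two) auto
    moreover have "(x, y) \<in> parcs G \<longleftrightarrow> x \<noteq> y \<and> \<not> (x \<in> pverts A \<and> y \<in> pverts B \<or> x \<in> pverts B \<and> y \<in> pverts A)"
      using that u disjoint unfolding vs(2) parcs verts arcs by auto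
    ultimately show ?thesis by auto
  qed
  have "det_minus_xI (distance_matrix (with_proj G) vs) = [:1, 1:] ^ (2 * t - 2)
    * [:2 * real t * (real t + 1), 3 * (real t)\<^sup>2 + 4 * real t - 1, 2 * real t - 2, -1:]"
    using vs verts fin disjoint u
    by (intro det_minus_xI_two_cliques_cone[OF t, where VA = "pverts A" and VB = "pverts B" and u = u])
       (auto simp: distance_matrix_def dist intro!: eq_matI)
  then have "(\<lambda>i. (-1) ^ (n - 1) * c i) = coeff ([:1, 1:] ^ (2 * t - 2)
    * [:2 * real t * (real t + 1), 3 * (real t)\<^sup>2 + 4 * real t - 1, 2 * real t - 2, -1:])"
    by (simp add: c n_eq fun_eq_iff del: mult_pCons_right)
  moreover have "n - 2 = 2 * t - 1" "n div 2 = t" using n_eq t by simp_all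
  ultimately show ?thesis using unimodal_cubic_times_binomial[OF t] by (simp only:)
qed

end
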